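(* Let $p$ be a prime and $f(x) = a_d x^d + \cdots + a_1x + a_0 \in \mathbb{Q}[x]$ be a polynomial of degree $d$ with $a_0 \neq 0$. Suppose that the successive vertices of the Newton polygon of $f$ with respect to $p$ are given by the set $$\{(0,0), (d-m_1, \nu_p(a_{m_1})), \dots, (d-m_{t-1}, \nu_p(a_{m_{t-1}})), (d, \nu_p(a_0))\}$$ (where $m_0=d$ and $m_t=0$), and that $\nu_p(a_{m_1})>0$. If $\nu_p(a_0) \leq \frac{\nu_p(a_{m_1})}{d-m_1} (2d-1)$, then for every $n \geq 1$ the successive vertices of the Newton polygon of $f^n$ with respect to $p$ are given by the set $$\{(0,0), (d^{n-1}(d-m_1), \nu_p(a_{m_1})), \dots, (d^{n-1}(d-m_{t-1}), \nu_p(a_{m_{t-1}})), (d^{n}, \nu_p(a_0))\}.$$ In particular, $f(x)$ is eventually stable.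
   Context: $\nu_p$ denotes the $p$-adic valuation on $\mathbb{Q}$, with $\nu_p(0)=+\infty$. For a polynomial $h(x)=\sum_{i=0}^{N} c_i x^i\in\mathbb{Q}[x]$ of degree $N$ with $h(0)\neq 0$, the Newton polygon of $h$ with respect to $p$ is the polygonal path formed by the lower edges along the convex hull in $\mathbb{R}^2$ of the points $(N-i,\nu_p(c_i))$, $0\le i\le N$ (points with $c_i=0$ are ignored). Its successive vertices, listed from left to right, are its two endpoints and the points where the slope changes. $f^n$ denotes the $n$-th iterate (composition) of $f$. A polynomial $f\in\mathbb{Q}[x]$ is eventually stable (over $\mathbb{Q}$) if there exists a constant $C_f$, depending only on $f$, such that for every $n\ge 1$ the number of irreducible factors of $f^n(x)$ over $\mathbb{Q}$ is bounded by $C_f$.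
   Formalization: The degree d is assumed to be at least 2; for d = 1 the statement is false: f = x + p satisfies all hypotheses, but f^p = x + p^2 has vertices (0,0), (1,2) instead of (0,0), (1,1). *)

theory Defs
  imports "HOL-Analysis.Analysis"
    "HOL-Computational_Algebra.Computational_Algebra" "HOL-Computational_Algebra.Field_as_Ring"
begin

(* The value at x = 0 is an artefact (the convention there is +infinity); below, only
   nonzero coefficients contribute points to a Newton polygon. *)
definition padic_val :: "nat \<Rightarrow> rat \<Rightarrow> int" where
  "padic_val p x =
     int (multiplicity (int p) (fst (quotient_of x)))
     - int (multiplicity (int p) (snd (quotient_of x)))"

definition newton_points :: "nat \<Rightarrow> rat poly \<Rightarrow> (real \<times> real) set" where
  "newton_points p h =
     {(real (degree h - i), real_of_int (padic_val p (coeff h i))) | i.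
        i \<le> degree h \<and> coeff h i \<noteq> 0}"

(* The Newton polygon is represented by the function on [0, degree h] whose graph is the
   lower boundary of the convex hull.  It is meaningful only for h(0) \<noteq> 0: otherwise the
   hull does not reach the abscissa degree h. *)
definition newton_polygon :: "nat \<Rightarrow> rat poly \<Rightarrow> real \<Rightarrow> real" where
  "newton_polygon p h x = Inf {y. (x, y) \<in> convex hull (newton_points p h)}"

(* s and s' are the slopes immediately to the left and to the right of x. *)
definition slope_changes_at :: "(real \<Rightarrow> real) \<Rightarrow> real \<Rightarrow> bool" where
  "slope_changes_at F x \<longleftrightarrow>
     (\<exists>s s' e. s \<noteq> s' \<and> e > 0 \<and>
        (\<forall>u\<in>{0..e}. F (x - u) = F x - s * u \<and> F (x + u) = F x + s' * u))"

definition newton_vertices :: "nat \<Rightarrow> rat poly \<Rightarrow> (real \<times> real) set" where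
  "newton_vertices p h =
     {(x, newton_polygon p h x) | x.
        x = 0 \<or> x = real (degree h) \<or>
        (0 < x \<and> x < real (degree h) \<and> slope_changes_at (newton_polygon p h) x)}"

definition poly_iterate :: "'a::comm_semiring_1 poly \<Rightarrow> nat \<Rightarrow> 'a poly" where
  "poly_iterate f n = (pcompose f ^^ n) [:0, 1:]"

(* Irreducible factors are counted with multiplicity. *)
definition eventually_stable :: "rat poly \<Rightarrow> bool" where
  "eventually_stable f \<longleftrightarrow>
     (\<exists>C. \<forall>n\<ge>1. size (prime_factorization (poly_iterate f n)) \<le> C)"

end

theory Submission
  imports Defs
begin

text \<open>
  Let \<open>P\<close> be the Newton polygon of \<open>f\<close> as a convex function on \<open>[0, d]\<close>, and let \<open>\<mu>\<close> be its first slope.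
  The bound \<open>v(a\<^sub>0) \<le> \<mu> (2 d - 1)\<close> implies that no slope of \<open>P\<close> exceeds \<open>d \<mu>\<close>.  Write the next iterate
  of \<open>g = f\<^sup>n\<close> as \<open>g \<circ> f = \<Sum>\<^sub>i b\<^sub>i f\<^sup>i\<close>.  Since \<open>v(a\<^sub>i) \<ge> \<mu> (d - i)\<close>, the \<open>k\<close>-th coefficient
  of \<open>b\<^sub>i f\<^sup>i\<close> has valuation at least \<open>v(b\<^sub>i) + \<mu> (d i - k)\<close>.  As the slopes of the polygon of \<open>g\<close> are at
  most \<open>d \<mu>\<close>, this is at least the height at \<open>k/d\<close> of the polygon of \<open>g\<close>, and for \<open>k = d i\<close>
  a vertex, only the term \<open>b\<^sub>i (a\<^sub>d x\<^sup>d)\<^sup>i\<close> attains it.  So composing with \<open>f\<close> stretches the polygon by \<open>d\<close>.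

  All slopes of \<open>f\<^sup>n\<close> are positive, so every irreducible factor takes at least \<open>1\<close> from
  \<open>v(f\<^sup>n(0)) = v(a\<^sub>0)\<close>, and there are at most \<open>v(a\<^sub>0)\<close> of them.
\<close>

section \<open>The p-adic valuation on the rationals\<close>

text \<open>Cross-multiplying with the reduced fraction and using additivity of
  \<open>multiplicity\<close> removes the dependence on \<open>quotient_of\<close>, so unreduced
  fractions and common denominators may be used.\<close>

lemma padic_val_of_int_divide:
  assumes "prime p" "a \<noteq> 0" "b \<noteq> 0"
  shows "padic_val p (of_int a / of_int b) = int (multiplicity (int p) a) - int (multiplicity (int p) b)"
proof -
  define x :: rat where "x = of_int a / of_int b"
  obtain c e where q: "quotient_of x = (c, e)" by (cases "quotient_of x")
  have e: "e > 0" using quotient_of_denom_pos[OF q] .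
  have x: "x = of_int c / of_int e" using quotient_of_div[OF q] .
  have "x \<noteq> 0" using assms by (simp add: x_def)
  hence c: "c \<noteq> 0" using x by auto
  have "(of_int (a * e) :: rat) = of_int (c * b)"
    using x e assms(3) unfolding x_def by (simp add: field_simps)
  hence eq: "a * e = c * b" by (simp only: of_int_eq_iff)
  have pp: "prime_elem (int p)" using assms(1) by simp
  have "multiplicity (int p) a + multiplicity (int p) e = multiplicity (int p) c + multiplicity (int p) b"
    using arg_cong[OF eq, of "multiplicity (int p)"] pp assms c e
    by (simp add: prime_elem_multiplicity_mult_distrib)
  thus ?thesis unfolding x_def[symmetric] padic_val_def q by simp
qed

lemma rat_as_fraction:
  obtains a b where "x = (of_int a / of_int b :: rat)" "b > 0"
  using quotient_of_div quotient_of_denom_pos by (metis surj_pair)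

lemma padic_val_mult:
  assumes "prime p" "x \<noteq> 0" "y \<noteq> 0"
  shows "padic_val p (x * y) = padic_val p x + padic_val p y"
proof -
  obtain a b where x: "x = of_int a / of_int b" "b > 0" by (rule rat_as_fraction)
  obtain c e where y: "y = of_int c / of_int e" "e > 0" by (rule rat_as_fraction)
  have nz: "a \<noteq> 0" "c \<noteq> 0" using x y assms by auto
  have "x * y = of_int (a * c) / of_int (b * e)" using x y by simp
  moreover have "prime_elem (int p)" using assms(1) by simp
  ultimately show ?thesis
    using nz x y assms(1)
    by (simp add: padic_val_of_int_divide prime_elem_multiplicity_mult_distrib
        del: of_int_mult)
qed

lemma padic_val_one [simp]: "padic_val p 1 = 0"
  by (simp add: padic_val_def)

lemma padic_val_minus: "prime p \<Longrightarrow> padic_val p (- x) = padic_val p x"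
proof (cases "x = 0")
  case False
  assume p: "prime p"
  obtain a b where x: "x = of_int a / of_int b" "b > 0" by (rule rat_as_fraction)
  have m: "- x = of_int (- a) / of_int b" and a: "a \<noteq> 0" using x False by auto
  have "padic_val p (- x) = int (multiplicity (int p) (- a)) - int (multiplicity (int p) b)"
    unfolding m using a x p by (intro padic_val_of_int_divide) auto
  thus ?thesis using x p a by (simp add: padic_val_of_int_divide)
qed simp

lemma padic_val_add_ge:
  assumes "prime p" "x \<noteq> 0" "y \<noteq> 0" "x + y \<noteq> 0"
  shows "min (padic_val p x) (padic_val p y) \<le> padic_val p (x + y)"
proof -
  obtain a b where x: "x = of_int a / of_int b" "b > 0" by (rule rat_as_fraction)
  obtain c e where y: "y = of_int c / of_int e" "e > 0" by (rule rat_as_fraction)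
  define u v w where "u = a * e" and "v = c * b" and "w = b * e"
  have w: "w \<noteq> 0" using x y by (simp add: w_def)
  have xu: "x = of_int u / of_int w" and yv: "y = of_int v / of_int w"
    using x y by (auto simp: u_def v_def w_def)
  have s: "x + y = of_int (u + v) / of_int w"
    unfolding xu yv by (simp add: add_divide_distrib)
  have nz: "u \<noteq> 0" "v \<noteq> 0" "u + v \<noteq> 0"
    using assms(2-4) xu yv s by auto
  have pp: "\<not> is_unit (int p)" using assms(1) by (auto dest: prime_gt_1_nat)
  define k where "k = min (multiplicity (int p) u) (multiplicity (int p) v)"
  have "int p ^ k dvd u + v"
    by (intro dvd_add multiplicity_dvd') (auto simp: k_def)
  hence "k \<le> multiplicity (int p) (u + v)"
    using nz pp by (intro multiplicity_geI) auto
  thus ?thesis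
    unfolding s unfolding xu yv using nz w assms(1)
    by (simp add: padic_val_of_int_divide k_def del: of_int_add)
qed

text \<open>The disjunct \<open>x = 0\<close> restores the convention that zero has infinite
  valuation, so lower bounds pass through sums and products uniformly.\<close>

definition padic_ge :: "nat \<Rightarrow> real \<Rightarrow> rat \<Rightarrow> bool" where
  "padic_ge p r x \<longleftrightarrow> x = 0 \<or> r \<le> real_of_int (padic_val p x)"

lemma padic_ge_0 [simp]: "padic_ge p r 0"
  by (simp add: padic_ge_def)

lemma padic_ge_mono: "padic_ge p r x \<Longrightarrow> s \<le> r \<Longrightarrow> padic_ge p s x"
  by (auto simp: padic_ge_def)

lemma padic_ge_mult:
  "prime p \<Longrightarrow> padic_ge p r x \<Longrightarrow> padic_ge p s y \<Longrightarrow> padic_ge p (r + s) (x * y)"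
  by (cases "x = 0 \<or> y = 0") (auto simp: padic_ge_def padic_val_mult)

lemma padic_ge_add:
  assumes "prime p" "padic_ge p r x" "padic_ge p r y"
  shows "padic_ge p r (x + y)"
proof (cases "x = 0 \<or> y = 0 \<or> x + y = 0")
  case False
  thus ?thesis using assms padic_val_add_ge[of p x y] by (auto simp: padic_ge_def)
qed (use assms in auto)

lemma padic_ge_sum:
  assumes "prime p" "\<And>i. i \<in> A \<Longrightarrow> padic_ge p r (F i)"
  shows "padic_ge p r (sum F A)"
  using assms(2) by (induction A rule: infinite_finite_induct) (auto intro: padic_ge_add assms(1))

lemma padic_val_add_eq:
  assumes "prime p" "x \<noteq> 0" "padic_ge p r y" "real_of_int (padic_val p x) < r"
  shows "x + y \<noteq> 0 \<and> padic_val p (x + y) = padic_val p x"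
proof (cases "y = 0")
  case False
  have lt: "padic_val p x < padic_val p y"
    using assms False by (auto simp: padic_ge_def)
  have nz: "x + y \<noteq> 0"
  proof
    assume "x + y = 0"
    hence "y = - x" by (simp add: eq_neg_iff_add_eq_0 add.commute)
    thus False using lt padic_val_minus[OF assms(1), of x] by simp
  qed
  have "min (padic_val p x) (padic_val p y) \<le> padic_val p (x + y)"
    using assms nz False by (intro padic_val_add_ge) auto
  \<comment> \<open>Cancelling \<open>y\<close> again gives the reverse inequality: the minimum
    cannot be the valuation of \<open>- y\<close>, which exceeds that of \<open>x\<close>.\<close>
  moreover have "min (padic_val p (x + y)) (padic_val p (- y)) \<le> padic_val p (x + y + - y)"
    using assms nz False by (intro padic_val_add_ge) auto
  ultimately show ?thesis using nz lt by (simp add: padic_val_minus[OF assms(1)])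
qed (use assms in auto)

lemma padic_val_sum_eq:
  assumes "prime p" "finite A" "k \<in> A" "F k \<noteq> 0"
    and "\<And>i. i \<in> A \<Longrightarrow> i \<noteq> k \<Longrightarrow> F i = 0 \<or> padic_val p (F k) < padic_val p (F i)"
  shows "sum F A \<noteq> 0 \<and> padic_val p (sum F A) = padic_val p (F k)"
proof -
  \<comment> \<open>Valuations are integers, so each strict inequality is a bound with
    \<open>+ 1\<close>, and such a bound survives summation.\<close>
  have "padic_ge p (real_of_int (padic_val p (F k)) + 1) (sum F (A - {k}))"
  proof (rule padic_ge_sum[OF assms(1)])
    fix i assume "i \<in> A - {k}"
    thus "padic_ge p (real_of_int (padic_val p (F k)) + 1) (F i)"
      using assms(5)[of i] by (auto simp: padic_ge_def)
  qed
  from padic_val_add_eq[OF assms(1,4) this]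
  show ?thesis by (simp add: sum.remove[OF assms(2,3)])
qed

section \<open>Factors of polynomials above a line\<close>

text \<open>Coefficient \<open>i\<close> has abscissa \<open>degree h - i\<close>, so the bound is
  the line of slope \<open>s\<close> through the leftmost Newton point.\<close>

definition above_line :: "nat \<Rightarrow> real \<Rightarrow> rat poly \<Rightarrow> bool" where
  "above_line p s h \<longleftrightarrow>
     (\<forall>i. padic_ge p (real_of_int (padic_val p (lead_coeff h)) + s * (real (degree h) - real i)) (coeff h i))"

lemma first_min_weight:
  fixes s :: real
  assumes "h \<noteq> (0 :: rat poly)"
  obtains i where "coeff h i \<noteq> 0"
    "\<And>j. coeff h j \<noteq> 0 \<Longrightarrow> real_of_int (padic_val p (coeff h i)) + s * i \<le> real_of_int (padic_val p (coeff h j)) + s * j"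
    "\<And>j. coeff h j \<noteq> 0 \<Longrightarrow> j < i \<Longrightarrow> real_of_int (padic_val p (coeff h i)) + s * i < real_of_int (padic_val p (coeff h j)) + s * j"
proof -
  define w where "w j = real_of_int (padic_val p (coeff h j)) + s * j" for j
  define A where "A = {j. coeff h j \<noteq> 0}"
  have A: "finite A" "A \<noteq> {}"
    using assms by (auto simp: A_def MOST_coeff_eq_0 eventually_cofinite[symmetric] poly_eq_iff)
  \<comment> \<open>The least element of the set of minimisers gives strictness at all smaller
    indices.\<close>
  define B where "B = {j \<in> A. w j = Min (w ` A)}"
  have "Min (w ` A) \<in> w ` A" using A by simp
  then obtain j where "j \<in> A" "w j = Min (w ` A)" by auto
  hence B: "finite B" "B \<noteq> {}" using A unfolding B_def by auto
  have i: "Min B \<in> B" using B by simp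
  have le: "w (Min B) \<le> w j" if "j \<in> A" for j using i that A by (auto simp: B_def)
  show ?thesis
  proof (rule that[of "Min B"])
    show "coeff h (Min B) \<noteq> 0" using i by (auto simp: B_def A_def)
    show "real_of_int (padic_val p (coeff h (Min B))) + s * (Min B) \<le> real_of_int (padic_val p (coeff h j)) + s * j"
      if "coeff h j \<noteq> 0" for j using le[of j] that by (simp add: A_def w_def)
    show "real_of_int (padic_val p (coeff h (Min B))) + s * (Min B) < real_of_int (padic_val p (coeff h j)) + s * j"
      if "coeff h j \<noteq> 0" "j < Min B" for j
    proof -
      have "j \<notin> B" using that B by (meson Min_le leD)
      hence "w j \<noteq> w (Min B)" using that i by (auto simp: B_def A_def)
      thus ?thesis using le[of j] that by (simp add: A_def w_def)
    qed
  qed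
qed

text \<open>Gauss's lemma for the valuation \<open>min\<^sub>i (v(c\<^sub>i) + s i)\<close>: if \<open>i\<close> and \<open>k\<close> are the first
  indices at which two factors attain the minimum, then a single summand of coefficient \<open>i + k\<close>
  of the product has the least valuation.\<close>

lemma above_line_factor:
  assumes p: "prime p" and nz: "g \<noteq> 0" "h \<noteq> 0" and above: "above_line p s (g * h)"
  shows "above_line p s g"
proof -
  let ?v = "\<lambda>x. real_of_int (padic_val p x)"
  obtain i where i: "coeff g i \<noteq> 0"
    "\<And>j. coeff g j \<noteq> 0 \<Longrightarrow> ?v (coeff g i) + s * i \<le> ?v (coeff g j) + s * j"
    "\<And>j. coeff g j \<noteq> 0 \<Longrightarrow> j < i \<Longrightarrow> ?v (coeff g i) + s * i < ?v (coeff g j) + s * j"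
    using first_min_weight[OF nz(1), where p = p and s = s] by metis
  obtain k where k: "coeff h k \<noteq> 0"
    "\<And>j. coeff h j \<noteq> 0 \<Longrightarrow> ?v (coeff h k) + s * k \<le> ?v (coeff h j) + s * j"
    "\<And>j. coeff h j \<noteq> 0 \<Longrightarrow> j < k \<Longrightarrow> ?v (coeff h k) + s * k < ?v (coeff h j) + s * j"
    using first_min_weight[OF nz(2), where p = p and s = s] by metis
  let ?F = "\<lambda>j. coeff g j * coeff h (i + k - j)"
  have "sum ?F {..i + k} \<noteq> 0 \<and> padic_val p (sum ?F {..i + k}) = padic_val p (?F i)"
  proof (rule padic_val_sum_eq[OF p])
    fix j assume j: "j \<in> {..i + k}" "j \<noteq> i"
    show "?F j = 0 \<or> padic_val p (?F i) < padic_val p (?F j)"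
    proof (cases "?F j = 0")
      case False
      have r: "real (i + k - j) = real i + real k - real j" using j by (simp add: of_nat_diff)
      have "?v (coeff g i) + s * i + (?v (coeff h k) + s * k)
              < ?v (coeff g j) + s * j + (?v (coeff h (i + k - j)) + s * (i + k - j))"
      \<comment> \<open>As \<open>j \<noteq> i\<close>, either \<open>j < i\<close> or
        \<open>i + k - j < k\<close>. One factor is then strictly heavier than its minimum, and the
        other is at least as heavy.\<close>
      proof (cases "j < i")
        case True
        thus ?thesis using i(3)[of j] k(2)[of "i + k - j"] False True r by (simp add: algebra_simps)
      next
        case False': False
        hence "i + k - j < k" using j by auto
        thus ?thesis using i(2)[of j] k(3)[of "i + k - j"] False r by (simp add: algebra_simps)
      qed
      hence "?v (coeff g i) + ?v (coeff h k) < ?v (coeff g j) + ?v (coeff h (i + k - j))"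
        unfolding r by (simp add: algebra_simps)
      thus ?thesis using False i(1) k(1) by (simp add: padic_val_mult[OF p])
    qed simp
  qed (use i k in auto)
  hence c: "coeff (g * h) (i + k) \<noteq> 0"
      "padic_val p (coeff (g * h) (i + k)) = padic_val p (coeff g i) + padic_val p (coeff h k)"
    using i(1) k(1) by (simp_all add: coeff_mult padic_val_mult[OF p])
  \<comment> \<open>The line bound for the product at \<open>i + k\<close>, minus minimality of
    \<open>k\<close> against the leading coefficient of \<open>h\<close>, shows that the leading
    coefficient of \<open>g\<close> has least weight. That is the claim for
    \<open>g\<close>.\<close>
  have "?v (lead_coeff g) + ?v (lead_coeff h) + s * (real (degree g) + real (degree h) - (real i + real k))
          \<le> ?v (coeff g i) + ?v (coeff h k)"
    using above[unfolded above_line_def padic_ge_def lead_coeff_mult degree_mult_eq[OF nz],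
        rule_format, of "i + k"] c nz
    by (simp add: coeff_mult_degree_sum padic_val_mult[OF p])
  moreover have "?v (coeff h k) + s * k \<le> ?v (lead_coeff h) + s * degree h"
    using k(2)[of "degree h"] nz by simp
  ultimately have "?v (lead_coeff g) + s * degree g \<le> ?v (coeff g i) + s * i"
    by (simp add: algebra_simps)
  thus ?thesis
    unfolding above_line_def padic_ge_def using i(2) by (force simp: algebra_simps)
qed

text \<open>By Gauss's lemma, each irreducible factor contributes at least \<open>s > 0\<close>, hence at least \<open>1\<close>, to
  the difference of valuations.\<close>

lemma size_prime_factorization_le:
  assumes p: "prime p" and s: "s > 0" and g: "above_line p s g" "coeff g 0 \<noteq> 0"
  shows "int (size (prime_factorization g)) \<le> padic_val p (coeff g 0) - padic_val p (lead_coeff g)"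
  using g
proof (induction g rule: prime_divisors_induct)
  case (unit x)
  hence "degree x = 0" using is_unit_iff_degree[of x] by fastforce
  thus ?case using unit by (simp add: prime_factorization_unit)
next
  case (factor q x)
  have nz: "q \<noteq> 0" "x \<noteq> 0" using factor by auto
  have c: "coeff q 0 \<noteq> 0" "coeff x 0 \<noteq> 0" using factor by (auto simp: coeff_mult)
  have "above_line p s q" "above_line p s x"
    using above_line_factor[OF p nz] above_line_factor[OF p nz(2,1)] factor by (simp_all add: mult.commute)
  note IH = factor(2)[OF this(2) c(2)]
  have "degree q > 0"
    using factor(1) nz by (metis is_unit_iff_degree not_prime_unit gr0I)
  hence "s * degree q > 0" using s by simp
  moreover have "real_of_int (padic_val p (lead_coeff q)) + s * degree q \<le> real_of_int (padic_val p (coeff q 0))"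
    using \<open>above_line p s q\<close>[unfolded above_line_def padic_ge_def, rule_format, of 0] c by simp
  ultimately have "padic_val p (lead_coeff q) < padic_val p (coeff q 0)" by linarith
  moreover have "prime_factorization (q * x) = add_mset q (prime_factorization x)"
    using nz factor(1) by (simp add: prime_factorization_mult prime_factorization_prime)
  ultimately show ?case
    using IH c nz lead_coeff_mult[of q x] by (simp add: coeff_mult_0 padic_val_mult[OF p])
qed simp

section \<open>Lower boundary of a planar convex hull\<close>

definition lower_boundary :: "(real \<times> real) set \<Rightarrow> real \<Rightarrow> real" where
  "lower_boundary K x = Inf {y. (x, y) \<in> K}"

text \<open>Vertical sections of a compact set are compact, so the infimum is a minimum. The point
  \<open>(x, y)\<close> excludes an empty section, whose \<open>Inf\<close> would be
  meaningless.\<close>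

lemma lower_boundary_attained:
  assumes "compact K" "(x, y) \<in> K"
  shows "(x, lower_boundary K x) \<in> K" "lower_boundary K x \<le> y"
proof -
  let ?Y = "{y. (x, y) \<in> K}"
  have eq: "?Y = snd ` (K \<inter> ({x} \<times> UNIV))" by force
  have "compact ?Y"
    unfolding eq
    by (intro compact_continuous_image continuous_intros compact_Int_closed assms closed_Times closed_UNIV closed_singleton)
  moreover have "?Y \<noteq> {}" using assms by auto
  ultimately have bdd: "bdd_below ?Y" and cl: "closed ?Y" and ne: "?Y \<noteq> {}"
    by (auto simp: compact_eq_bounded_closed bounded_imp_bdd_below)
  have "Inf ?Y \<in> ?Y" by (rule closed_contains_Inf[OF ne bdd cl])
  thus "(x, lower_boundary K x) \<in> K" by (simp add: lower_boundary_def)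
  show "lower_boundary K x \<le> y"
    unfolding lower_boundary_def using assms(2) bdd by (intro cInf_lower) auto
qed

lemma lower_boundary_eqI:
  assumes "(x, y) \<in> K" "\<And>y'. (x, y') \<in> K \<Longrightarrow> y \<le> y'"
  shows "lower_boundary K x = y"
  unfolding lower_boundary_def using assms by (intro cInf_eq_minimum) auto

lemma convex_lower_boundary:
  assumes "compact K" "convex K" "(a, y) \<in> K" "(b, y') \<in> K" "0 \<le> u" "u \<le> 1"
  shows "((1 - u) * a + u * b, (1 - u) * lower_boundary K a + u * lower_boundary K b) \<in> K"
    "lower_boundary K ((1 - u) * a + u * b) \<le> (1 - u) * lower_boundary K a + u * lower_boundary K b"
proof -
  have "(1 - u) *\<^sub>R (a, lower_boundary K a) + u *\<^sub>R (b, lower_boundary K b) \<in> K"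
    using assms lower_boundary_attained[OF assms(1)] by (intro convexD) auto
  thus 1: "((1 - u) * a + u * b, (1 - u) * lower_boundary K a + u * lower_boundary K b) \<in> K"
    by simp
  show "lower_boundary K ((1 - u) * a + u * b) \<le> (1 - u) * lower_boundary K a + u * lower_boundary K b"
    using lower_boundary_attained(2)[OF assms(1) 1] .
qed

lemma hull_above_line:
  fixes S :: "(real \<times> real) set"
  assumes "\<And>a b. (a, b) \<in> S \<Longrightarrow> c + s * a \<le> b" "(x, y) \<in> convex hull S"
  shows "c + s * x \<le> y"
proof -
  \<comment> \<open>The normal vector \<open>(s, - 1)\<close> writes the region above the line as a
    half-plane.\<close>
  have "convex {q :: real \<times> real. (s, - 1) \<bullet> q \<le> - c}" by (rule convex_halfspace_le)
  hence "convex hull S \<subseteq> {q. (s, - 1) \<bullet> q \<le> - c}"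
    using assms(1) by (intro hull_minimal) (auto simp: inner_prod_def algebra_simps)
  thus ?thesis using assms(2) by (auto simp: inner_prod_def algebra_simps)
qed

text \<open>The direction \<open>\<sigma> = 1\<close> gives the slope to the right of \<open>x\<close>, and \<open>\<sigma> = -1\<close> the slope to the left.\<close>

lemma lower_boundary_one_sided_slope:
  fixes S :: "(real \<times> real) set"
  assumes S: "finite S" and \<sigma>: "\<sigma> \<in> {1, -1 :: real}"
    and x: "(x, y) \<in> convex hull S" and q: "q \<in> S" "\<sigma> * (fst q - x) > 0"
  obtains s e where "e > 0"
    "\<And>u. 0 \<le> u \<Longrightarrow> u \<le> e \<Longrightarrow> lower_boundary (convex hull S) (x + \<sigma> * u)
        = lower_boundary (convex hull S) x + s * u"
proof -
  let ?P = "lower_boundary (convex hull S)"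
  have K: "compact (convex hull S)" using S by (rule finite_imp_compact_convex_hull)
  \<comment> \<open>The edge leaving the boundary point over \<open>x\<close> has the least slope
    among the segments from that point to the points of \<open>S\<close> on the chosen side.\<close>
  define T where "T = {q \<in> S. \<sigma> * (fst q - x) > 0}"
  define sl where "sl q = (snd q - ?P x) / (\<sigma> * (fst q - x))" for q
  have T: "finite T" "T \<noteq> {}" unfolding T_def using S q by (simp, blast)
  then obtain r where r: "r \<in> T" "sl r = Min (sl ` T)"
    using Min_in[of "sl ` T"] by (metis (mono_tags, lifting) finite_imageI image_iff image_is_empty)
  define s where "s = sl r"
  define e where "e = \<sigma> * (fst r - x)"
  have e: "e > 0" using r by (simp add: e_def T_def)
  have \<sigma>2: "\<sigma> * (\<sigma> * z) = z" for z using \<sigma> by auto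
  have fr: "fst r = x + \<sigma> * e" by (simp add: e_def \<sigma>2)
  have sr: "snd r = ?P x + s * e"
    using e by (simp add: s_def sl_def e_def[symmetric])
  have rS: "(x + \<sigma> * e, ?P x + s * e) \<in> S"
    using r fr sr by (metis (mono_tags, lifting) T_def mem_Collect_eq prod.collapse)
  have above: "?P x + s * (\<sigma> * (a - x)) \<le> b" if ab: "(a, b) \<in> S" for a b
  proof -
    define w where "w = \<sigma> * (a - x)"
    have a: "a = x + \<sigma> * w" by (simp add: w_def \<sigma>2)
    have abK: "(a, b) \<in> convex hull S" using ab by (rule hull_inc)
    consider "w > 0" | "w = 0" | "w < 0" by linarith
    hence "?P x + s * w \<le> b"
    proof cases
      case 1
      hence "(a, b) \<in> T" using ab by (simp add: T_def w_def)
      hence "s \<le> sl (a, b)" using r T by (simp add: s_def)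
      thus ?thesis using 1 by (simp add: sl_def w_def[symmetric] pos_le_divide_eq)
    next
      case 2
      thus ?thesis using lower_boundary_attained(2)[OF K abK] a by simp
    next
      case 3
      \<comment> \<open>A point on the other side is joined to the chosen \<open>r\<close>;
        \<open>u\<close> is the parameter at which this segment crosses the vertical line through
        \<open>x\<close>, where it cannot pass below the boundary.\<close>
      define u where "u = - w / (e - w)"
      have u: "0 \<le> u" "u \<le> 1" "(1 - u) * w + u * e = 0"
        using 3 e by (auto simp: u_def field_simps)
      have "(1 - u) *\<^sub>R (a, b) + u *\<^sub>R (x + \<sigma> * e, ?P x + s * e) \<in> convex hull S"
        using u abK hull_inc[OF rS] by (intro convexD convex_convex_hull) auto
      moreover have "(1 - u) * a + u * (x + \<sigma> * e) = x + \<sigma> * ((1 - u) * w + u * e)"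
        by (simp add: a algebra_simps)
      ultimately have "(x, (1 - u) * b + u * (?P x + s * e)) \<in> convex hull S"
        using u by simp
      hence "?P x \<le> (1 - u) * b + u * (?P x + s * e)"
        by (rule lower_boundary_attained(2)[OF K])
      hence "(1 - u) * ?P x \<le> (1 - u) * b + s * (u * e)" by (simp add: algebra_simps)
      also have "u * e = - (1 - u) * w" using u(3) by (simp add: algebra_simps)
      finally have "(1 - u) * (?P x + s * w) \<le> (1 - u) * b" by (simp add: algebra_simps)
      moreover have "1 - u > 0" using 3 e by (simp add: u_def field_simps)
      ultimately show ?thesis by simp
    qed
    thus ?thesis by (simp add: w_def)
  qed
  show ?thesis
  proof (rule that[OF e])
    fix u assume u: "0 \<le> u" "u \<le> e"
    define v where "v = u / e"
    have v: "0 \<le> v" "v \<le> 1" "v * e = u" using u e by (auto simp: v_def)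
    have "(1 - v) *\<^sub>R (x, ?P x) + v *\<^sub>R (x + \<sigma> * e, ?P x + s * e) \<in> convex hull S"
      using v lower_boundary_attained(1)[OF K x] hull_inc[OF rS]
      by (intro convexD convex_convex_hull) auto
    hence "(x + \<sigma> * (v * e), ?P x + s * (v * e)) \<in> convex hull S"
      by (simp add: algebra_simps)
    hence "(x + \<sigma> * u, ?P x + s * u) \<in> convex hull S" by (simp add: v)
    moreover have "?P x + s * u \<le> b" if "(x + \<sigma> * u, b) \<in> convex hull S" for b
    proof -
      have "(?P x - s * \<sigma> * x) + (s * \<sigma>) * (x + \<sigma> * u) \<le> b"
        by (rule hull_above_line[OF _ that]) (use above in \<open>auto simp: algebra_simps\<close>)
      thus ?thesis using \<sigma>2[of "s * u"] by (simp add: algebra_simps)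
    qed
    ultimately show "?P (x + \<sigma> * u) = ?P x + s * u" by (intro lower_boundary_eqI)
  qed
qed

text \<open>If the lower boundary were below its chord, the leftmost point of \<open>[a, b]\<close> at which it
  is furthest below the chord would be a point where the slope changes.\<close>

lemma lower_boundary_affine:
  fixes S :: "(real \<times> real) set"
  defines "P \<equiv> lower_boundary (convex hull S)"
  assumes S: "finite S" and ab: "a < b" "(a, ya) \<in> convex hull S" "(b, yb) \<in> convex hull S"
    and ns: "\<And>x. a < x \<Longrightarrow> x < b \<Longrightarrow> \<not> slope_changes_at P x"
    and x: "a \<le> x" "x \<le> b"
  shows "P x = P a + (P b - P a) / (b - a) * (x - a)"
proof (rule ccontr)
  let ?H = "convex hull S"
  have K: "compact ?H" using S by (rule finite_imp_compact_convex_hull)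
  define l where "l = (P b - P a) / (b - a)"
  define D where "D z = P z - P a - l * (z - a)" for z
  assume "P x \<noteq> P a + (P b - P a) / (b - a) * (x - a)"
  hence Dx: "D x \<noteq> 0" by (simp add: D_def l_def)
  have Da: "D a = 0" and Db: "D b = 0" using ab by (auto simp: D_def l_def)
  have inH: "(z, P z) \<in> ?H" and Dle: "D z \<le> 0" if z: "a \<le> z" "z \<le> b" for z
  proof -
    define u where "u = (z - a) / (b - a)"
    have u: "0 \<le> u" "u \<le> 1" "u * (b - a) = z - a" using z ab by (auto simp: u_def)
    have eq: "(1 - u) * a + u * b = z" using u(3) by (simp add: algebra_simps)
    note c = convex_lower_boundary[OF K convex_convex_hull ab(2,3) u(1,2), unfolded eq, folded P_def]
    show "(z, P z) \<in> ?H" unfolding P_def by (rule lower_boundary_attained[OF K c(1)])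
    have "P z \<le> P a + u * (P b - P a)" using c(2) by (simp add: algebra_simps)
    also have "u * (P b - P a) = l * (z - a)" by (simp add: u_def l_def)
    finally show "D z \<le> 0" by (simp add: D_def)
  qed
  \<comment> \<open>To avoid continuity of \<open>P\<close>, the linear functional
    \<open>\<phi>\<close> is minimised over a compact strip of the hull. On the graph it differs
    from \<open>D\<close> by a constant, and a second minimisation, of the abscissa over the
    minimisers, gives the leftmost point.\<close>
  define Q where "Q = ?H \<inter> {a..b} \<times> UNIV"
  have Q: "compact Q" unfolding Q_def by (intro compact_Int_closed K closed_Times) auto
  have inQ: "(z, P z) \<in> Q" if "a \<le> z" "z \<le> b" for z using inH that by (auto simp: Q_def)
  define \<phi> where "\<phi> q = snd q - l * fst q" for q :: "real \<times> real"
  have cont: "continuous_on X \<phi>" for X unfolding \<phi>_def by (intro continuous_intros)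
  obtain q where q: "q \<in> Q" "\<And>q'. q' \<in> Q \<Longrightarrow> \<phi> q \<le> \<phi> q'"
    using continuous_attains_inf[OF Q _ cont] inQ[OF x] by blast
  define R where "R = Q \<inter> \<phi> -` {\<phi> q}"
  have "closed (\<phi> -` {\<phi> q})" by (intro closed_vimage cont) auto
  hence R: "compact R" unfolding R_def by (intro compact_Int_closed Q)
  obtain z where z: "z \<in> R" "\<And>z'. z' \<in> R \<Longrightarrow> fst z \<le> fst z'"
    using continuous_attains_inf[OF R, of fst] q by (force simp: R_def intro: continuous_intros)
  define z0 where "z0 = fst z"
  have z0: "a \<le> z0" "z0 \<le> b" and zQ: "(z0, snd z) \<in> ?H"
    using z by (auto simp: R_def Q_def z0_def)
  have \<phi>D: "\<phi> (w, P w) = D w + P a - l * a" for w by (simp add: \<phi>_def D_def algebra_simps)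
  have "P z0 \<le> snd z" unfolding P_def by (rule lower_boundary_attained[OF K zQ])
  hence "\<phi> (z0, P z0) \<le> \<phi> z" by (simp add: \<phi>_def z0_def)
  moreover have \<phi>z: "\<phi> z = \<phi> q" using z by (simp add: R_def)
  ultimately have \<phi>z0: "\<phi> (z0, P z0) = \<phi> q" using q(2)[OF inQ[OF z0]] by simp
  have min: "D z0 \<le> D w" if "a \<le> w" "w \<le> b" for w
    using q(2)[OF inQ[OF that]] \<phi>z0 \<phi>D by simp
  have less: "D z0 < D w" if "a \<le> w" "w < z0" for w
  proof -
    have wb: "w \<le> b" using that z0 by simp
    have "\<phi> (w, P w) \<noteq> \<phi> q"
      using z(2)[of "(w, P w)"] inQ[OF that(1) wb] that by (auto simp: R_def z0_def)
    thus ?thesis using min[OF that(1) wb] \<phi>z0 \<phi>D by (metis order_less_le)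
  qed
  have "D z0 < 0" using min[OF x] Dle[OF x] Dx by simp
  hence za: "a < z0" "z0 < b" using Da Db z0 by (auto simp: order_less_le)
  have right: "\<exists>q\<in>S. fst q > z0"
  proof (rule ccontr)
    assume "\<not> ?thesis"
    hence "?H \<subseteq> {q. (1, 0) \<bullet> q \<le> z0}"
      by (intro hull_minimal convex_halfspace_le) (auto simp: inner_prod_def not_less)
    thus False using ab za by (auto simp: inner_prod_def)
  qed
  have left: "\<exists>q\<in>S. fst q < z0"
  proof (rule ccontr)
    assume "\<not> ?thesis"
    hence "?H \<subseteq> {q. (1, 0) \<bullet> q \<ge> z0}"
      by (intro hull_minimal convex_halfspace_ge) (auto simp: inner_prod_def not_less)
    thus False using ab za by (auto simp: inner_prod_def)
  qed
  obtain s e where e: "e > 0" "\<And>u. 0 \<le> u \<Longrightarrow> u \<le> e \<Longrightarrow> P (z0 + u) = P z0 + s * u"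
  proof -
    from right obtain q where "q \<in> S" "1 * (fst q - z0) > 0" by auto
    from lower_boundary_one_sided_slope[OF S _ zQ this] that show ?thesis
      unfolding P_def by (metis insertI1 mult_1)
  qed
  obtain r e' where e': "e' > 0" "\<And>u. 0 \<le> u \<Longrightarrow> u \<le> e' \<Longrightarrow> P (z0 - u) = P z0 + r * u"
  proof -
    from left obtain q where "q \<in> S" "- 1 * (fst q - z0) > 0" by auto
    from lower_boundary_one_sided_slope[OF S _ zQ this] obtain s e where
      "e > 0" "\<And>u. 0 \<le> u \<Longrightarrow> u \<le> e \<Longrightarrow> P (z0 + (- 1) * u) = P z0 + s * u"
      unfolding P_def by blast
    thus ?thesis using that[of e s] by simp
  qed
  define u where "u = min (min e e') (min (b - z0) (z0 - a))"
  have u: "u > 0" "u \<le> e" "u \<le> e'" "z0 + u \<le> b" "a \<le> z0 - u"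
    using e e' za by (auto simp: u_def)
  \<comment> \<open>Leftmost minimality is strict to the left and weak to the right, so
    \<open>- r < l \<le> s\<close>. In the sign convention of \<open>slope_changes_at\<close> the
    left slope is \<open>- r\<close>.\<close>
  have "D z0 < D (z0 - u)" using less[of "z0 - u"] u by simp
  hence "0 < (r + l) * u" using e'(2)[of u] u by (simp add: D_def algebra_simps)
  moreover have "D z0 \<le> D (z0 + u)" using min[of "z0 + u"] u by simp
  hence "0 \<le> (s - l) * u" using e(2)[of u] u by (simp add: D_def algebra_simps)
  ultimately have "- r < s" using u(1) by (simp add: zero_less_mult_iff zero_le_mult_iff)
  hence "- r \<noteq> s" by simp
  moreover have "min e e' > 0" using e(1) e'(1) by simp
  moreover have "\<forall>u\<in>{0..min e e'}. P (z0 - u) = P z0 - (- r) * u \<and> P (z0 + u) = P z0 + s * u"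
    using e(2) e'(2) by simp
  ultimately have "slope_changes_at P z0"
    unfolding slope_changes_at_def by blast
  thus False using ns za by blast
qed

section \<open>Behaviour of slope changes under localisation and stretching\<close>

lemma slope_changes_at_cong:
  assumes "\<delta> > 0" "\<And>y. \<bar>y - x\<bar> < \<delta> \<Longrightarrow> F y = G y" "slope_changes_at F x"
  shows "slope_changes_at G x"
proof -
  obtain s s' e where s: "s \<noteq> s'" "e > 0"
    "\<And>u. u \<in> {0..e} \<Longrightarrow> F (x - u) = F x - s * u \<and> F (x + u) = F x + s' * u"
    using assms(3) unfolding slope_changes_at_def by blast
  show ?thesis
    unfolding slope_changes_at_def
  proof (rule exI[of _ s], rule exI[of _ s'], rule exI[of _ "min e (\<delta> / 2)"], intro conjI ballI)
    fix u assume u: "u \<in> {0..min e (\<delta> / 2)}"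
    have "F (x - u) = G (x - u)" "F (x + u) = G (x + u)" "F x = G x"
      using u assms(1) by (auto intro!: assms(2))
    with s(3)[of u] u show "G (x - u) = G x - s * u" "G (x + u) = G x + s' * u" by auto
  qed (use s assms in auto)
qed

lemma slope_changes_at_stretch:
  assumes "c > 0" "slope_changes_at F x"
  shows "slope_changes_at (\<lambda>y. F (y / c)) (c * x)"
proof -
  obtain s s' e where s: "s \<noteq> s'" "e > 0"
    "\<And>u. u \<in> {0..e} \<Longrightarrow> F (x - u) = F x - s * u \<and> F (x + u) = F x + s' * u"
    using assms(2) unfolding slope_changes_at_def by blast
  show ?thesis
    unfolding slope_changes_at_def
  proof (rule exI[of _ "s / c"], rule exI[of _ "s' / c"], rule exI[of _ "c * e"], intro conjI ballI)
    fix u assume "u \<in> {0..c * e}"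
    hence "u / c \<in> {0..e}" using assms(1) by (simp add: field_simps)
    from s(3)[OF this] show "F ((c * x - u) / c) = F (c * x / c) - s / c * u"
      "F ((c * x + u) / c) = F (c * x / c) + s' / c * u"
      using assms(1) by (simp_all add: diff_divide_distrib add_divide_distrib)
  qed (use s assms in auto)
qed

text \<open>The set \<open>E\<close> is a lexicographic half-plane. It is convex although not
  closed, so no supporting line has to be constructed.\<close>

lemma lower_boundary_left_end:
  fixes S :: "(real \<times> real) set"
  assumes "(0, c) \<in> S" "\<And>a b. (a, b) \<in> S \<Longrightarrow> 0 < a \<or> a = 0 \<and> c \<le> b"
  shows "lower_boundary (convex hull S) 0 = c"
proof (rule lower_boundary_eqI)
  show "(0, c) \<in> convex hull S" using assms(1) by (rule hull_inc)
  define E where "E = {q :: real \<times> real. 0 < fst q \<or> fst q = 0 \<and> c \<le> snd q}"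
  have "convex E"
    unfolding convex_alt
  proof (intro ballI allI impI)
    fix q r u assume q: "q \<in> E" and r: "r \<in> E" and u: "0 \<le> u \<and> u \<le> (1 :: real)"
    consider "u = 0" | "u = 1" | "0 < u" "u < 1" using u by force
    thus "(1 - u) *\<^sub>R q + u *\<^sub>R r \<in> E"
    proof cases
      case 3
      hence nn: "0 \<le> (1 - u) * fst q" "0 \<le> u * fst r" using q r by (auto simp: E_def)
      show ?thesis
      proof (cases "fst q = 0 \<and> fst r = 0")
        case True
        have "(1 - u) * c + u * c \<le> (1 - u) * snd q + u * snd r"
          using True q r u by (intro add_mono mult_left_mono) (auto simp: E_def)
        thus ?thesis using True by (simp add: E_def algebra_simps)
      next
        case False
        hence "0 < (1 - u) * fst q \<or> 0 < u * fst r" using q r 3 by (auto simp: E_def)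
        thus ?thesis using nn by (auto simp: E_def)
      qed
    qed (use q r in auto)
  qed
  hence "convex hull S \<subseteq> E" using assms(2) by (intro hull_minimal) (force simp: E_def)+
  thus "c \<le> y" if "(0, y) \<in> convex hull S" for y using that by (auto simp: E_def)
qed

lemma between_consecutive:
  fixes x :: "nat \<Rightarrow> real"
  assumes "t \<ge> 1" "x 0 \<le> z" "z \<le> x t"
  shows "\<exists>j<t. x j \<le> z \<and> z \<le> x (Suc j)"
  using assms
proof (induction t rule: nat_induct_at_least)
  case (Suc n)
  thus ?case by (cases "z \<le> x n") (auto intro: less_SucI)
qed auto

section \<open>Composition stretches the Newton polygon\<close>

lemma padic_val_power: "prime p \<Longrightarrow> x \<noteq> 0 \<Longrightarrow> padic_val p (x ^ n) = int n * padic_val p x"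
  by (induction n) (simp_all add: padic_val_mult algebra_simps)

lemma coeff_pcompose: "coeff (pcompose g f) k = (\<Sum>i\<le>degree g. coeff g i * coeff (f ^ i) k)"
  for f g :: "'a :: comm_semiring_1 poly"
proof -
  have d: "degree (map_poly (\<lambda>x. [:x:]) g) = degree g"
    by (intro degree_map_poly) auto
  have "pcompose g f = (\<Sum>i\<le>degree g. [:coeff g i:] * f ^ i)"
    unfolding pcompose_altdef poly_altdef d by (simp add: coeff_map_poly)
  thus ?thesis by (simp add: coeff_sum)
qed

lemma coeff_power_degree: "coeff (f ^ i) (i * degree f) = lead_coeff f ^ i"
  for f :: "'a :: idom poly"
proof (cases "f = 0")
  case False
  thus ?thesis using lead_coeff_power[of f i] by (simp add: degree_power_eq)
qed (simp add: coeff_0_power)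

lemma newton_polygon_eq: "newton_polygon p h = lower_boundary (convex hull (newton_points p h))"
  by (simp add: newton_polygon_def lower_boundary_def fun_eq_iff)

lemma finite_newton_points: "finite (newton_points p h)"
proof -
  have "newton_points p h \<subseteq> (\<lambda>i. (real (degree h - i), real_of_int (padic_val p (coeff h i)))) ` {..degree h}"
    by (auto simp: newton_points_def)
  thus ?thesis by (rule finite_subset) auto
qed

lemma newton_vertices_stretch:
  assumes c: "c > 0" and deg: "real (degree g) = c * real (degree f)"
    and eq: "\<And>x. 0 \<le> x \<Longrightarrow> x \<le> real (degree g) \<Longrightarrow> newton_polygon p g x = newton_polygon p f (x / c)"
  shows "newton_vertices p g = (\<lambda>(x, y). (c * x, y)) ` newton_vertices p f"
proof -
  have slope: "slope_changes_at (newton_polygon p g) (c * x) \<longleftrightarrow> slope_changes_at (newton_polygon p f) x"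
    if x: "0 < x" "x < real (degree f)" for x
  proof
    assume "slope_changes_at (newton_polygon p g) (c * x)"
    from slope_changes_at_stretch[OF _ this, of "1 / c"] c
    have "slope_changes_at (\<lambda>y. newton_polygon p g (y * c)) x" by simp
    thus "slope_changes_at (newton_polygon p f) x"
    \<comment> \<open>The two polygons are only known to correspond over the intervals up to the
      degrees, so the comparison uses a window around \<open>x\<close> inside that range.\<close>
    proof (rule slope_changes_at_cong[of "min x (real (degree f) - x)", rotated 2])
      fix y assume "\<bar>y - x\<bar> < min x (real (degree f) - x)"
      hence "0 \<le> y" "y \<le> real (degree f)" by linarith+
      thus "newton_polygon p g (y * c) = newton_polygon p f y"
        using eq[of "y * c"] c deg by simp
    qed (use x in auto)
  next
    assume "slope_changes_at (newton_polygon p f) x"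
    from slope_changes_at_stretch[OF c this]
    show "slope_changes_at (newton_polygon p g) (c * x)"
    proof (rule slope_changes_at_cong[of "c * min x (real (degree f) - x)", rotated 2])
      fix y assume y: "\<bar>y - c * x\<bar> < c * min x (real (degree f) - x)"
      have "c * min x (real (degree f) - x) \<le> c * x"
        "c * min x (real (degree f) - x) \<le> c * (real (degree f) - x)"
        using c by simp_all
      hence "0 \<le> y" "y \<le> real (degree g)" using y deg by (auto simp: right_diff_distrib)
      thus "newton_polygon p f (y / c) = newton_polygon p g y" using eq by simp
    qed (use x c in auto)
  qed
  define A where "A h = {x. x = 0 \<or> x = real (degree h) \<or> 0 < x \<and> x < real (degree h)
      \<and> slope_changes_at (newton_polygon p h) x}" for h
  have mem: "x \<in> A f \<longleftrightarrow> c * x \<in> A g" for x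
    using c deg slope[of x] by (auto simp: A_def zero_less_mult_iff)
  have "A g = (*) c ` A f"
  proof (intro set_eqI iffI)
    fix x assume "x \<in> A g"
    hence "x / c \<in> A f" using c by (simp add: mem)
    thus "x \<in> (*) c ` A f" by (rule rev_image_eqI) (use c in simp)
  qed (use mem in auto)
  moreover have "newton_polygon p g (c * x) = newton_polygon p f x" if "x \<in> A f" for x
    using eq[of "c * x"] that c deg by (auto simp: A_def)
  moreover have "newton_vertices p h = (\<lambda>x. (x, newton_polygon p h x)) ` A h" for h
    by (auto simp: newton_vertices_def A_def)
  ultimately show ?thesis by (simp add: image_image cong: image_cong)
qed

text \<open>Here \<open>P\<close> is the Newton polygon of \<open>f\<close> as a function, \<open>\<mu>\<close> its first slope and \<open>M\<close> the set of
  coefficient indices of its vertices.  The assumptions on slopes encode the hypothesis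
  \<open>v(a\<^sub>0) \<le> \<mu> (2 d - 1)\<close>.\<close>

locale stretched_polygon =
  fixes p d :: nat and f :: "rat poly" and P :: "real \<Rightarrow> real" and \<mu> :: real and M :: "nat set"
  assumes p: "prime p" and degree_f: "degree f = d" and d2: "d \<ge> 2" and \<mu>: "\<mu> > 0"
    and P_0: "P 0 = 0"
    and P_ge: "\<And>x. 0 \<le> x \<Longrightarrow> x \<le> real d \<Longrightarrow> \<mu> * x \<le> P x"
    and P_convex: "\<And>a b u. 0 \<le> a \<Longrightarrow> a \<le> real d \<Longrightarrow> 0 \<le> b \<Longrightarrow> b \<le> real d \<Longrightarrow> 0 \<le> u \<Longrightarrow> u \<le> 1
        \<Longrightarrow> P ((1 - u) * a + u * b) \<le> (1 - u) * P a + u * P b"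
    and P_slope: "\<And>z w. 0 \<le> z \<Longrightarrow> z \<le> w \<Longrightarrow> w \<le> real d \<Longrightarrow> P w \<le> P z + real d * \<mu> * (w - z)"
    and P_slope_strict: "\<And>z w. 0 \<le> z \<Longrightarrow> z < w \<Longrightarrow> w \<le> real d - 1
        \<Longrightarrow> P w < P z + real d * \<mu> * (w - z)"
    and P_interpolates: "\<And>z. 0 \<le> z \<Longrightarrow> z \<le> real d \<Longrightarrow> \<exists>a\<in>M. \<exists>b\<in>M. \<exists>u\<in>{0..1}.
        z = (1 - u) * (real d - real a) + u * (real d - real b) \<and>
        P z = (1 - u) * P (real d - real a) + u * P (real d - real b)"
    and coeff_ge: "\<And>i. i \<le> d \<Longrightarrow> padic_ge p (P (real d - real i)) (coeff f i)"
    and M_le: "\<And>i. i \<in> M \<Longrightarrow> i \<le> d"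
    and M_coeff: "\<And>i. i \<in> M \<Longrightarrow> coeff f i \<noteq> 0"
    and M_val: "\<And>i. i \<in> M \<Longrightarrow> real_of_int (padic_val p (coeff f i)) = P (real d - real i)"
    and M_0: "0 \<in> M" and M_d: "d \<in> M"
begin

text \<open>The Newton polygon of \<open>g\<close> is that of \<open>f\<close>, stretched horizontally by the factor \<open>N\<close>.\<close>

definition shape :: "nat \<Rightarrow> rat poly \<Rightarrow> bool" where
  "shape N g \<longleftrightarrow> degree g = N * d
     \<and> (\<forall>i\<le>N * d. padic_ge p (P (real d - real i / real N)) (coeff g i))
     \<and> (\<forall>i\<in>M. coeff g (N * i) \<noteq> 0 \<and> real_of_int (padic_val p (coeff g (N * i))) = P (real d - real i))"

lemma lead_coeff_val: "padic_val p (coeff f d) = 0"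
  using M_val[OF M_d] P_0 by simp

text \<open>The coefficients of \<open>f\<close> satisfy this bound by \<open>P_ge\<close>, and in
  the convolution the bounds \<open>\<mu> * (real d - real a)\<close> and
  \<open>\<mu> * (real d * real i - real (k - a))\<close> add up.\<close>

lemma coeff_power_ge: "padic_ge p (\<mu> * (real d * real i - real k)) (coeff (f ^ i) k)"
proof (induction i arbitrary: k)
  case 0
  thus ?case by (auto simp: padic_ge_def)
next
  case (Suc i)
  have f: "padic_ge p (\<mu> * (real d - real a)) (coeff f a)" for a
  proof (cases "a \<le> d")
    case True
    thus ?thesis using P_ge[of "real d - real a"] by (intro padic_ge_mono[OF coeff_ge]) auto
  qed (simp add: coeff_eq_0 degree_f)
  show ?case
    unfolding power_Suc coeff_mult
  proof (rule padic_ge_sum[OF p])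
    fix a assume "a \<in> {..k}"
    hence "\<mu> * (real d - real a) + \<mu> * (real d * real i - real (k - a))
        = \<mu> * (real d * real (Suc i) - real k)"
      by (simp add: of_nat_diff algebra_simps)
    thus "padic_ge p (\<mu> * (real d * real (Suc i) - real k)) (coeff f a * coeff (f ^ i) (k - a))"
      using padic_ge_mult[OF p f Suc.IH] by metis
  qed
qed

lemma shape_f: "shape 1 f"
  using degree_f coeff_ge M_coeff M_val by (simp add: shape_def)

lemma shape_pcompose:
  assumes N: "N \<ge> 1" and g: "shape N g"
  shows "shape (N * d) (pcompose g f)"
proof -
  let ?T = "\<lambda>k i. coeff g i * coeff (f ^ i) k"
  have deg_g: "degree g = N * d" using g by (simp add: shape_def)
  \<comment> \<open>Dividing the nonnegative \<open>\<mu> * (real d * real i - real k)\<close> by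
    \<open>N\<close> only weakens it. The result is the rise of a line of slope
    \<open>real d * \<mu>\<close> between the rescaled abscissas of \<open>i\<close> and
    \<open>k\<close>, as needed for \<open>P_slope\<close>.\<close>
  have term_ge: "padic_ge p (P (real d - real i / real N)
        + real d * \<mu> * (real i / real N - real k / real (N * d))) (?T k i)"
    if "i \<le> N * d" "k \<le> d * i" for i k
  proof -
    have k: "real k \<le> real d * real i" using that by (metis of_nat_le_iff of_nat_mult)
    have "real i / real N - real k / real (N * d) = (real d * real i - real k) / real (N * d)"
      using N d2 by (simp add: field_simps)
    hence "real d * \<mu> * (real i / real N - real k / real (N * d))
        = \<mu> * (real d * real i - real k) / real N"
      using N d2 by simp
    also have "\<dots> \<le> \<mu> * (real d * real i - real k) / 1"
      using N \<mu> k by (intro divide_left_mono) auto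
    finally show ?thesis
      using g that by (intro padic_ge_mono[OF padic_ge_mult[OF p _ coeff_power_ge]])
        (auto simp: shape_def)
  qed
  have term_0: "?T k i = 0" if "d * i < k" for i k
    using that degree_power_le[of f i] degree_f by (simp add: coeff_eq_0)
  have ge: "padic_ge p (P (real d - real k / real (N * d))) (coeff (pcompose g f) k)"
    if k: "k \<le> N * d * d" for k
    unfolding coeff_pcompose deg_g
  proof (rule padic_ge_sum[OF p])
    fix i assume i: "i \<in> {..N * d}"
    show "padic_ge p (P (real d - real k / real (N * d))) (?T k i)"
    proof (cases "d * i < k")
      case False
      have "real k / real (N * d) \<le> real i / real N"
        using False N d2 by (simp add: field_simps flip: of_nat_mult)
      moreover have "real i / real N \<le> real d"
        using i N by (simp add: field_simps flip: of_nat_mult)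
      ultimately have "P (real d - real k / real (N * d)) \<le> P (real d - real i / real N)
        + real d * \<mu> * ((real d - real k / real (N * d)) - (real d - real i / real N))"
        by (intro P_slope) auto
      thus ?thesis using i False by (intro padic_ge_mono[OF term_ge]) auto
    qed (simp add: term_0)
  qed
  have "coeff (pcompose g f) (N * d * m) \<noteq> 0
      \<and> padic_val p (coeff (pcompose g f) (N * d * m)) = padic_val p (?T (N * d * m) (N * m))
      \<and> real_of_int (padic_val p (?T (N * d * m) (N * m))) = P (real d - real m)"
    if m: "m \<in> M" for m
  proof -
    let ?k = "N * d * m"
    have md: "m \<le> d" using M_le[OF m] .
    have a_d: "coeff f d \<noteq> 0" using M_coeff[OF M_d] .
    have main: "?T ?k (N * m) = coeff g (N * m) * coeff f d ^ (N * m)"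
      using coeff_power_degree[of f "N * m"] by (simp add: degree_f algebra_simps)
    have g_m: "coeff g (N * m) \<noteq> 0" "real_of_int (padic_val p (coeff g (N * m))) = P (real d - real m)"
      using g m by (auto simp: shape_def)
    have main_val: "real_of_int (padic_val p (?T ?k (N * m))) = P (real d - real m)"
      using g_m a_d unfolding main by (simp add: padic_val_mult[OF p] padic_val_power[OF p] lead_coeff_val)
    have "sum (?T ?k) {..N * d} \<noteq> 0 \<and> padic_val p (sum (?T ?k) {..N * d}) = padic_val p (?T ?k (N * m))"
    proof (rule padic_val_sum_eq[OF p])
      show "N * m \<in> {..N * d}" using md by simp
      show "?T ?k (N * m) \<noteq> 0" unfolding main using g_m a_d by simp
      fix i assume i: "i \<in> {..N * d}" "i \<noteq> N * m"
      show "?T ?k i = 0 \<or> padic_val p (?T ?k (N * m)) < padic_val p (?T ?k i)"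
      proof (cases "?T ?k i = 0")
        case False
        \<comment> \<open>For \<open>i < N * m\<close> the degree of \<open>f ^ i\<close> is below
          \<open>N * d * m\<close>, so that summand vanishes.\<close>
        have "N * m < i"
          using term_0[of i ?k] False i d2 by (cases "i < N * m") auto
        define z where "z = real d - real i / real N"
        have z: "0 \<le> z" "z < real d - real m"
          using i \<open>N * m < i\<close> N by (auto simp: z_def field_simps simp flip: of_nat_mult)
        have "P (real d - real m) < real_of_int (padic_val p (?T ?k i))"
        proof (cases "m = 0")
          case True
          \<comment> \<open>The bound \<open>term_ge\<close> need not be strict here; instead, compare with \<open>g i * (f 0) ^ i\<close>.\<close>
          have f_0: "coeff f 0 \<noteq> 0" "real_of_int (padic_val p (coeff f 0)) = P (real d)"
            using M_coeff[OF M_0] M_val[OF M_0] by auto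
          have g_i: "coeff g i \<noteq> 0" using False by auto
          have "P z \<le> real_of_int (padic_val p (coeff g i))"
            using g i g_i by (auto simp: shape_def padic_ge_def z_def)
          moreover have "real_of_int (padic_val p (?T ?k i))
              = real_of_int (padic_val p (coeff g i)) + real i * P (real d)"
            using True f_0 g_i by (simp add: coeff_0_power padic_val_mult[OF p] padic_val_power[OF p])
          moreover have "P (real d) < P z + real i * P (real d)"
          proof -
            have "0 < \<mu> * real d" using \<mu> d2 by simp
            hence Pd: "0 < P (real d)" using P_ge[of "real d"] by linarith
            have Pz: "\<mu> * z \<le> P z" using P_ge z by simp
            have \<mu>z: "0 \<le> \<mu> * z" using \<mu> z by simp
            show ?thesis
            \<comment> \<open>For \<open>i = 1\<close> the abscissa \<open>z\<close> is positive,
              hence so is \<open>P z\<close>; for \<open>i \<ge> 2\<close> the factor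
              \<open>i\<close> alone gives strictness.\<close>
            proof (cases "i = 1")
              case True
              have "1 / real N \<le> 1" using N by simp
              hence "0 < z" using d2 True by (simp add: z_def)
              hence "0 < \<mu> * z" using \<mu> by simp
              thus ?thesis using Pz True by simp
            next
              case False
              hence "2 * P (real d) \<le> real i * P (real d)"
                using Pd \<open>N * m < i\<close> by (intro mult_right_mono) auto
              thus ?thesis using Pd Pz \<mu>z by linarith
            qed
          qed
          ultimately show ?thesis using True by simp
        next
          case m0: False
          \<comment> \<open>Now \<open>m \<ge> 1\<close>, so the vertex has abscissa at most
            \<open>real d - 1\<close>, the range in which the slope bound is strict.\<close>
          have "P (real d - real m) < P z + real d * \<mu> * ((real d - real m) - z)"
            using z m0 by (intro P_slope_strict) auto
          moreover have "P z + real d * \<mu> * ((real d - real m) - z) \<le> real_of_int (padic_val p (?T ?k i))"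
          proof -
            have "d * (N * m) \<le> d * i" using \<open>N * m < i\<close> by (intro mult_left_mono) auto
            hence "?k \<le> d * i" by (simp add: algebra_simps)
            from term_ge[OF _ this] i False N d2 show ?thesis
              by (simp add: padic_ge_def z_def)
          qed
          ultimately show ?thesis by linarith
        qed
        thus ?thesis using main_val by linarith
      qed simp
    qed auto
    thus ?thesis using main_val unfolding coeff_pcompose deg_g by blast
  qed
  moreover have "degree (pcompose g f) = N * d * d"
    by (simp add: degree_pcompose deg_g degree_f)
  ultimately show ?thesis using ge unfolding shape_def by metis
qed

lemma shape_poly_iterate: "n \<ge> 1 \<Longrightarrow> shape (d ^ (n - 1)) (poly_iterate f n)"
proof (induction n rule: nat_induct_at_least)
  case base
  show ?case using shape_f by (simp add: poly_iterate_def pcompose_idR)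
next
  case (Suc n)
  \<comment> \<open>Iterates are built by composing with \<open>f\<close> on the left; associativity
    moves the new \<open>f\<close> to the right, as \<open>shape_pcompose\<close> requires.\<close>
  have "poly_iterate f (Suc n) = pcompose (poly_iterate f n) f" for n
  proof (induction n)
    case (Suc n)
    have "poly_iterate f (Suc (Suc n)) = pcompose f (poly_iterate f (Suc n))"
      by (simp add: poly_iterate_def)
    also have "\<dots> = pcompose (pcompose f (poly_iterate f n)) f"
      by (simp add: Suc.IH pcompose_assoc)
    finally show ?case by (simp add: poly_iterate_def)
  qed (simp add: poly_iterate_def pcompose_idR pcompose_pCons)
  moreover have "d ^ (n - 1) * d = d ^ n" using Suc.hyps by (cases n) auto
  moreover have "d ^ (n - 1) \<ge> 1" using d2 by simp
  ultimately show ?case using shape_pcompose[OF _ Suc.IH] by simp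
qed

text \<open>Interpolation between vertices puts the stretched graph of \<open>P\<close> into the
  hull. Conversely, the stretched epigraph \<open>E\<close> is convex and contains all Newton
  points, so nothing in the hull lies lower.\<close>

lemma newton_polygon_shape:
  assumes N: "N \<ge> 1" and g: "shape N g" and x: "0 \<le> x" "x \<le> real N * real d"
  shows "newton_polygon p g x = P (x / real N)"
  unfolding newton_polygon_eq
proof (rule lower_boundary_eqI)
  let ?S = "newton_points p g"
  have deg: "degree g = N * d" using g by (simp add: shape_def)
  have in_S: "(real N * (real d - real a), P (real d - real a)) \<in> convex hull ?S" if a: "a \<in> M" for a
  proof (rule hull_inc)
    have "N * a \<le> N * d" using M_le[OF a] by simp
    hence "real N * (real d - real a) = real (N * d - N * a)"
      by (simp add: of_nat_diff right_diff_distrib)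
    moreover have "P (real d - real a) = real_of_int (padic_val p (coeff g (N * a)))"
      "coeff g (N * a) \<noteq> 0"
      using g a by (auto simp: shape_def)
    ultimately show "(real N * (real d - real a), P (real d - real a)) \<in> ?S"
      using \<open>N * a \<le> N * d\<close> unfolding newton_points_def deg by blast
  qed
  have xN: "0 \<le> x / real N" "x / real N \<le> real d"
    using x N by (auto simp: field_simps)
  obtain a b u where abu: "a \<in> M" "b \<in> M" "u \<in> {0..1}"
      "x / real N = (1 - u) * (real d - real a) + u * (real d - real b)"
      "P (x / real N) = (1 - u) * P (real d - real a) + u * P (real d - real b)"
    using P_interpolates[OF xN] by blast
  have "(1 - u) *\<^sub>R (real N * (real d - real a), P (real d - real a))
      + u *\<^sub>R (real N * (real d - real b), P (real d - real b)) \<in> convex hull ?S"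
    using abu in_S by (intro convexD convex_convex_hull) auto
  moreover have "x = (1 - u) * (real N * (real d - real a)) + u * (real N * (real d - real b))"
  proof -
    have "x = real N * (x / real N)" using N by simp
    thus ?thesis unfolding abu(4) by (simp add: algebra_simps)
  qed
  ultimately show "(x, P (x / real N)) \<in> convex hull ?S"
    unfolding abu(5) by simp
  define E where "E = {q. 0 \<le> fst q \<and> fst q \<le> real d * real N \<and> P (fst q / real N) \<le> snd q}"
  have "convex E"
    unfolding convex_alt
  proof (intro ballI allI impI)
    fix q r u assume q: "q \<in> E" and r: "r \<in> E" and u: "0 \<le> u \<and> u \<le> (1 :: real)"
    have "P ((1 - u) * (fst q / real N) + u * (fst r / real N))
        \<le> (1 - u) * P (fst q / real N) + u * P (fst r / real N)"
      using q r u N by (intro P_convex) (auto simp: E_def divide_le_eq)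
    also have "\<dots> \<le> (1 - u) * snd q + u * snd r"
      using q r u by (intro add_mono mult_left_mono) (auto simp: E_def)
    finally have "P (((1 - u) * fst q + u * fst r) / real N) \<le> (1 - u) * snd q + u * snd r"
      by (simp add: add_divide_distrib)
    moreover have "(1 - u) * fst q + u * fst r \<le> (1 - u) * (real d * real N) + u * (real d * real N)"
      using q r u by (intro add_mono mult_left_mono) (auto simp: E_def)
    hence "(1 - u) * fst q + u * fst r \<le> real d * real N" by (simp add: algebra_simps)
    ultimately show "(1 - u) *\<^sub>R q + u *\<^sub>R r \<in> E"
      using q r u by (simp add: E_def)
  qed
  moreover have "?S \<subseteq> E"
  proof
    fix q assume "q \<in> ?S"
    then obtain i where i: "i \<le> N * d" "coeff g i \<noteq> 0"
      "q = (real (N * d - i), real_of_int (padic_val p (coeff g i)))"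
      unfolding newton_points_def deg by blast
    have "P (real d - real i / real N) \<le> real_of_int (padic_val p (coeff g i))"
      using g i by (auto simp: shape_def padic_ge_def)
    moreover have "real (N * d - i) / real N = real d - real i / real N"
      using i N by (simp add: of_nat_diff diff_divide_distrib)
    ultimately show "q \<in> E" using i by (simp add: E_def mult.commute[of d N] flip: of_nat_mult)
  qed
  ultimately have "convex hull ?S \<subseteq> E" by (rule hull_minimal[rotated])
  thus "P (x / real N) \<le> y" if "(x, y) \<in> convex hull ?S" for y
    using that by (auto simp: E_def)
qed

text \<open>The line of slope \<open>\<mu> / real N\<close> lies under the polygon of the iterate.
  The slope depends on \<open>n\<close>, but the count needs only its positivity, and the end
  valuations are those of \<open>f\<close>.\<close>

lemma eventually_stable_f: "eventually_stable f"
  unfolding eventually_stable_def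
proof (intro exI allI impI)
  fix n :: nat assume n: "n \<ge> 1"
  define g N where "g = poly_iterate f n" and "N = d ^ (n - 1)"
  have N: "N > 0" using d2 by (simp add: N_def)
  have g: "shape N g" using shape_poly_iterate[OF n] by (simp add: g_def N_def)
  have deg: "degree g = N * d" using g by (simp add: shape_def)
  have lead: "padic_val p (lead_coeff g) = 0"
    using g M_d P_0 unfolding deg by (auto simp: shape_def)
  have g_0: "coeff g 0 \<noteq> 0" "padic_val p (coeff g 0) = padic_val p (coeff f 0)"
    using g M_0 M_val[OF M_0] by (force simp: shape_def)+
  have above: "above_line p (\<mu> / real N) g"
    unfolding above_line_def
  proof
    fix i
    show "padic_ge p (real_of_int (padic_val p (lead_coeff g)) + \<mu> / real N * (real (degree g) - real i)) (coeff g i)"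
    proof (cases "i \<le> N * d")
      case True
      hence "real i / real N \<le> real d" using N by (simp add: field_simps flip: of_nat_mult)
      hence "\<mu> * (real d - real i / real N) \<le> P (real d - real i / real N)" by (intro P_ge) auto
      moreover have "\<mu> / real N * (real (degree g) - real i) = \<mu> * (real d - real i / real N)"
        using N by (simp add: deg field_simps)
      moreover have "padic_ge p (P (real d - real i / real N)) (coeff g i)"
        using g True by (simp add: shape_def)
      ultimately show ?thesis unfolding lead by (simp add: padic_ge_mono)
    qed (simp add: coeff_eq_0 deg)
  qed
  have "\<mu> / real N > 0" using \<mu> N by simp
  from size_prime_factorization_le[OF p this above g_0(1)]
  have "int (size (prime_factorization g)) \<le> padic_val p (coeff f 0)"
    by (simp add: lead g_0(2))
  thus "size (prime_factorization (poly_iterate f n)) \<le> nat (padic_val p (coeff f 0))"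
    by (simp add: g_def)
qed

end

section \<open>The Newton polygons of the iterates\<close>

theorem theorem1p3:
  fixes p d t :: nat and f :: "rat poly" and m :: "nat \<Rightarrow> nat"
  assumes "prime p"
    and "degree f = d" and "d \<ge> 2"
    and "coeff f 0 \<noteq> 0"
    and "t \<ge> 1" and "m 0 = d" and "m t = 0" and "\<forall>j<t. m (Suc j) < m j"
    and "newton_vertices p f =
           insert (0, 0)
             ((\<lambda>j. (real d - real (m j), real_of_int (padic_val p (coeff f (m j))))) ` {1..t})"
    and "padic_val p (coeff f (m 1)) > 0"
    and "real_of_int (padic_val p (coeff f 0))
           \<le> real_of_int (padic_val p (coeff f (m 1))) / (real d - real (m 1)) * (2 * real d - 1)"
  shows "(\<forall>n\<ge>1.
            coeff (poly_iterate f n) 0 \<noteq> 0 \<and>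
            newton_vertices p (poly_iterate f n) =
              insert (0, 0)
                ((\<lambda>j. (real d ^ (n - 1) * (real d - real (m j)),
                       real_of_int (padic_val p (coeff f (m j))))) ` {1..t}))
         \<and> eventually_stable f"
proof -

  \<comment> \<open>The polygon of \<open>f\<close> as a piecewise affine convex function\<close>
  define P where "P = newton_polygon p f"
  define S where "S = newton_points p f"
  define x where "x j = real d - real (m j)" for j
  define v where "v i = real_of_int (padic_val p (coeff f i))" for i
  define \<mu> where "\<mu> = v (m 1) / x 1"
  define M where "M = m ` {0..t}"
  have P: "P = lower_boundary (convex hull S)"
    by (simp add: P_def S_def newton_polygon_eq)
  have S: "finite S" unfolding S_def by (rule finite_newton_points)
  have K: "compact (convex hull S)" using S by (rule finite_imp_compact_convex_hull)
  have m_less: "m j < m i" if "i < j" "j \<le> t" for i j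
    using that
  proof (induction j)
    case (Suc j)
    have "m (Suc j) < m j" using assms(8) Suc.prems by auto
    thus ?case using Suc by (cases "i = j") auto
  qed simp
  have m_le: "m j \<le> m i" if "i \<le> j" "j \<le> t" for i j
    using m_less[of i j] that by (cases "i = j") auto
  have x_0: "x 0 = 0" and x_t: "x t = real d" using assms(6,7) by (simp_all add: x_def)
  have x_pos: "0 < x j" if "1 \<le> j" "j \<le> t" for j
    using m_less[of 0 j] that assms(6) by (simp add: x_def)
  have S_mem: "(real d - real i, v i) \<in> S" if "i \<le> d" "coeff f i \<noteq> 0" for i
    using that assms(2) unfolding S_def newton_points_def v_def by force
  have f_d: "coeff f d \<noteq> 0" using assms(2,3) by auto
  have ends: "(0, v d) \<in> S" "(real d, v 0) \<in> S"
    using S_mem[of d] S_mem[of 0] f_d assms(4) by auto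
  have hull: "(z, P z) \<in> convex hull S" if z: "0 \<le> z" "z \<le> real d" for z
  proof -
    \<comment> \<open>The chord between the two end points supplies a hull point over
      \<open>z\<close>, so the infimum there is attained.\<close>
    have "(1 - z / real d) *\<^sub>R (0, v d) + (z / real d) *\<^sub>R (real d, v 0) \<in> convex hull S"
      using ends z assms(3) by (intro convexD convex_convex_hull hull_inc) auto
    hence "(z, (1 - z / real d) * v d + z / real d * v 0) \<in> convex hull S"
      using assms(3) by simp
    thus ?thesis unfolding P by (rule lower_boundary_attained(1)[OF K])
  qed
  have P_convex: "P ((1 - u) * a + u * b) \<le> (1 - u) * P a + u * P b"
    if "0 \<le> a" "a \<le> real d" "0 \<le> b" "b \<le> real d" "0 \<le> u" "u \<le> 1" for a b u
    unfolding P using convex_lower_boundary(2)[OF K convex_convex_hull hull hull] that by blast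
  have vertices: "newton_vertices p f = insert (0, 0) ((\<lambda>j. (x j, v (m j))) ` {1..t})"
    using assms(9) by (simp add: x_def v_def)
  have vertexD: "y = P z" if "(z, y) \<in> newton_vertices p f" for z y
    using that by (auto simp: newton_vertices_def P_def)
  have P_0: "P 0 = 0" using vertexD[of 0 0] vertices by simp
  have P_x: "P (x j) = v (m j)" if "1 \<le> j" "j \<le> t" for j
    using vertexD[of "x j" "v (m j)"] that unfolding vertices by fastforce
  have no_slope_change: "\<not> slope_changes_at P z" if j: "j < t" "x j < z" "z < x (Suc j)" for j z
  proof
    assume "slope_changes_at P z"
    moreover have "0 < z" using j x_0 x_pos[of j] by (cases "j = 0") auto
    moreover have "z < real d" using j by (simp add: x_def)
    ultimately have "(z, P z) \<in> newton_vertices p f"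
      by (auto simp: newton_vertices_def P_def assms(2))
    \<comment> \<open>A slope change would be a listed vertex \<open>x i\<close>, but the abscissas
      increase with the index and none lies strictly between consecutive ones.\<close>
    then obtain i where i: "1 \<le> i" "i \<le> t" "z = x i"
      using vertices \<open>0 < z\<close> by auto
    show False using j i m_le[of i j] m_le[of "Suc j" i] by (cases "i \<le> j") (auto simp: x_def)
  qed
  have affine: "P z = P (x j) + (P (x (Suc j)) - P (x j)) / (x (Suc j) - x j) * (z - x j)"
    if j: "j < t" "x j \<le> z" "z \<le> x (Suc j)" for j z
  proof -
    have b: "0 \<le> x i" "x i \<le> real d" if "i \<le> t" for i
      using x_0 x_pos[of i] that by (cases "i = 0", auto simp: x_def)
    show ?thesis unfolding P
    proof (rule lower_boundary_affine[OF S])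
      show "x j < x (Suc j)" using assms(8) j by (simp add: x_def)
      show "(x j, P (x j)) \<in> convex hull S" "(x (Suc j), P (x (Suc j))) \<in> convex hull S"
        using hull b j by auto
    qed (use j no_slope_change P in auto)
  qed

  \<comment> \<open>Slope bounds from the hypothesis on the constant coefficient\<close>
  have x_1: "0 < x 1" "x 1 \<le> real d" using x_pos assms(5) by (auto simp: x_def)
  have \<mu>: "\<mu> > 0" using x_1 assms(10) by (simp add: \<mu>_def v_def)
  have P_ge: "\<mu> * z \<le> P z" if z: "0 \<le> z" "z \<le> real d" for z
  proof (cases "z \<le> x 1")
    case True
    thus ?thesis using affine[of 0 z] z x_0 P_0 P_x[of 1] assms(5) by (simp add: \<mu>_def)
  next
    case False
    \<comment> \<open>Beyond the first edge, convexity between \<open>0\<close> and \<open>z\<close>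
      is applied at \<open>x 1 = u * z\<close>, where \<open>P\<close> equals
      \<open>\<mu> * x 1\<close>.\<close>
    define u where "u = x 1 / z"
    have u: "0 < u" "u \<le> 1" "u * z = x 1" using x_1 False by (auto simp: u_def)
    have "v (m 1) \<le> u * P z"
      using P_convex[of 0 z u] z u P_0 P_x[of 1] assms(5) by simp
    moreover have "v (m 1) = \<mu> * x 1" using x_1 by (simp add: \<mu>_def)
    hence "v (m 1) = u * (\<mu> * z)" unfolding u(3)[symmetric] by simp
    ultimately show ?thesis using u by simp
  qed
  have P_d: "P (real d) \<le> \<mu> * (2 * real d - 1)"
    using P_x[of t] x_t assms(5,7,11) by (simp add: \<mu>_def v_def x_def)
  \<comment> \<open>This is the source of \<open>2 * d - 1\<close>: the line of slope
    \<open>real d * \<mu>\<close> through \<open>(d, \<mu> * (2 * d - 1))\<close> meets the line of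
    slope \<open>\<mu>\<close> through the origin exactly at abscissa \<open>d - 1\<close>.\<close>
  have far: "P (real d) - real d * \<mu> * (real d - z)
      = \<mu> * z - \<mu> * ((real d - 1) * (real d - 1 - z)) - (\<mu> * (2 * real d - 1) - P (real d))" for z
    by (simp add: algebra_simps)
  have last_slope: "P (real d) \<le> P z + real d * \<mu> * (real d - z)" if z: "0 \<le> z" "z \<le> real d" for z
  proof (cases "z \<le> real d - 1")
    case True
    hence "0 \<le> \<mu> * ((real d - 1) * (real d - 1 - z))" using \<mu> assms(3) by simp
    thus ?thesis using far[of z] P_ge[OF z] P_d by linarith
  next
    case False
    \<comment> \<open>Vertices have integer abscissas, so \<open>P\<close> is affine on the last
      unit interval. Its slope \<open>s\<close> there is bounded by comparison at
      \<open>real d - 1\<close>, where the two lines meet.\<close>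
    have "m (t - 1) \<ge> 1" using m_less[of "t - 1" t] assms(5) by simp
    hence x_le: "x (t - 1) \<le> real d - 1" by (simp add: x_def)
    define s where "s = (P (real d) - P (x (t - 1))) / (real d - x (t - 1))"
    have line: "P y = P (real d) - s * (real d - y)" if "x (t - 1) \<le> y" "y \<le> real d" for y
    proof -
      have "P y = P (x (t - 1)) + s * (y - x (t - 1))"
        using affine[of "t - 1" y] that assms(5) x_t by (simp add: s_def)
      moreover have "s * (real d - x (t - 1)) = P (real d) - P (x (t - 1))"
        using x_le by (simp add: s_def)
      ultimately show ?thesis by (simp add: algebra_simps)
    qed
    have "\<mu> * (real d - 1) \<le> P (real d - 1)" using P_ge assms(3) by simp
    hence "s \<le> real d * \<mu>" using line[of "real d - 1"] x_le far[of "real d - 1"] P_d by simp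
    hence "s * (real d - z) \<le> real d * \<mu> * (real d - z)" using z by (intro mult_right_mono) auto
    thus ?thesis using line[of z] False x_le z by simp
  qed
  \<comment> \<open>By convexity, a slope bound from \<open>z\<close> to the right end
    \<open>real d\<close> carries over to every intermediate \<open>w\<close>.\<close>
  have chord: "P w \<le> P z + (w - z) / (real d - z) * (P (real d) - P z)"
    if "0 \<le> z" "z < real d" "z \<le> w" "w \<le> real d" for z w
  proof -
    define u where "u = (w - z) / (real d - z)"
    have u: "0 \<le> u" "u \<le> 1" "u * (real d - z) = w - z" using that by (auto simp: u_def)
    have "(1 - u) * z + u * real d = w" using u(3) by (simp add: algebra_simps)
    thus ?thesis using P_convex[of z "real d" u] u that by (simp add: u_def[symmetric] algebra_simps)
  qed
  interpret stretched_polygon p d f P \<mu> M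
  proof
    show "prime p" "degree f = d" "2 \<le> d" "0 < \<mu>" "P 0 = 0" using assms \<mu> P_0 by auto
    show "\<mu> * z \<le> P z" if "0 \<le> z" "z \<le> real d" for z using P_ge that .
    show "P ((1 - u) * a + u * b) \<le> (1 - u) * P a + u * P b"
      if "0 \<le> a" "a \<le> real d" "0 \<le> b" "b \<le> real d" "0 \<le> u" "u \<le> 1" for a b u
      using P_convex that .
    show "P w \<le> P z + real d * \<mu> * (w - z)" if zw: "0 \<le> z" "z \<le> w" "w \<le> real d" for z w
    proof (cases "z = real d")
      case False
      hence "(w - z) / (real d - z) * (P (real d) - P z)
          \<le> (w - z) / (real d - z) * (real d * \<mu> * (real d - z))"
        using zw last_slope[of z] by (intro mult_left_mono) auto
      also have "\<dots> = real d * \<mu> * (w - z)" using False by simp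
      finally show ?thesis using chord[of z w] zw False by simp
    qed (use zw in auto)
    show "P w < P z + real d * \<mu> * (w - z)" if zw: "0 \<le> z" "z < w" "w \<le> real d - 1" for z w
    proof -
      \<comment> \<open>Here \<open>z < real d - 1\<close> is strictly left of the crossing point of
        the two lines in \<open>far\<close>, whence strictness.\<close>
      have "0 < \<mu> * ((real d - 1) * (real d - 1 - z))" using \<mu> assms(3) zw by simp
      hence "P (real d) - P z < real d * \<mu> * (real d - z)"
        using far[of z] P_ge[of z] P_d zw by linarith
      hence "(w - z) / (real d - z) * (P (real d) - P z)
          < (w - z) / (real d - z) * (real d * \<mu> * (real d - z))"
        using zw by (intro mult_strict_left_mono) auto
      also have "\<dots> = real d * \<mu> * (w - z)" using zw by simp
      finally show ?thesis using chord[of z w] zw by simp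
    qed
    show "\<exists>a\<in>M. \<exists>b\<in>M. \<exists>u\<in>{0..1}. z = (1 - u) * (real d - real a) + u * (real d - real b) \<and>
        P z = (1 - u) * P (real d - real a) + u * P (real d - real b)"
      if z: "0 \<le> z" "z \<le> real d" for z
    proof -
      obtain j where j: "j < t" "x j \<le> z" "z \<le> x (Suc j)"
        using between_consecutive[of t x z] assms(5) z x_0 x_t by auto
      define u where "u = (z - x j) / (x (Suc j) - x j)"
      have lt: "x j < x (Suc j)" using assms(8) j by (simp add: x_def)
      hence u: "u \<in> {0..1}" "u * (x (Suc j) - x j) = z - x j" using j by (auto simp: u_def)
      have "P z = P (x j) + u * (P (x (Suc j)) - P (x j))"
        using affine[OF j] by (simp add: u_def)
      hence "P z = (1 - u) * P (x j) + u * P (x (Suc j))" by (simp add: algebra_simps)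
      moreover have "z = (1 - u) * x j + u * x (Suc j)" using u by (simp add: algebra_simps)
      moreover have "m j \<in> M" "m (Suc j) \<in> M" using j by (auto simp: M_def)
      ultimately show ?thesis using u(1) unfolding x_def by blast
    qed
    show "padic_ge p (P (real d - real i)) (coeff f i)" if "i \<le> d" for i
      using lower_boundary_attained(2)[OF K hull_inc[OF S_mem]] that
      unfolding P padic_ge_def v_def by blast
    fix i assume "i \<in> M"
    then obtain j where j: "j \<le> t" "i = m j" by (auto simp: M_def)
    show "i \<le> d" using m_le[of 0 j] j assms(6) by simp
    have "coeff f i \<noteq> 0 \<and> v i = P (real d - real i)"
    proof (cases "j = 0")
      case True
      \<comment> \<open>Only the leading coefficient has abscissa \<open>0\<close>; with
        \<open>P 0 = 0\<close> its valuation is therefore zero.\<close>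
      have "P 0 = v d"
        unfolding P
      proof (rule lower_boundary_left_end[OF ends(1)])
        show "0 < a \<or> a = 0 \<and> v d \<le> b" if "(a, b) \<in> S" for a b
          using that by (auto simp: S_def newton_points_def v_def assms(2))
      qed
      thus ?thesis using True j f_d assms(6) by simp
    next
      case False
      hence "0 < x j" "P (x j) = v i" "x j \<le> real d" using j x_pos P_x by (auto simp: x_def)
      moreover have "0 < \<mu> * x j" using \<mu> calculation by simp
      ultimately have "0 < v i" using P_ge[of "x j"] by simp
      \<comment> \<open>By its default value \<open>padic_val p 0\<close> is \<open>0\<close>, so a
        positive value certifies a nonzero coefficient.\<close>
      hence "coeff f i \<noteq> 0" by (auto simp: v_def padic_val_def)
      thus ?thesis using \<open>P (x j) = v i\<close> j by (simp add: x_def)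
    qed
    thus "coeff f i \<noteq> 0" "real_of_int (padic_val p (coeff f i)) = P (real d - real i)"
      by (auto simp: v_def)
  next
    show "0 \<in> M" "d \<in> M" using assms(6,7) unfolding M_def by force+
  qed
  have "coeff (poly_iterate f n) 0 \<noteq> 0 \<and> newton_vertices p (poly_iterate f n) =
      insert (0, 0) ((\<lambda>j. (real d ^ (n - 1) * (real d - real (m j)),
        real_of_int (padic_val p (coeff f (m j))))) ` {1..t})" if n: "n \<ge> 1" for n
  proof -
    note shape = shape_poly_iterate[OF n]
    have N: "d ^ (n - 1) \<ge> 1" using assms(3) by simp
    have "coeff (poly_iterate f n) 0 \<noteq> 0" using shape M_0 by (force simp: shape_def)
    moreover have "newton_vertices p (poly_iterate f n)
        = (\<lambda>(x, y). (real d ^ (n - 1) * x, y)) ` newton_vertices p f"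
    proof (rule newton_vertices_stretch)
      show deg: "real (degree (poly_iterate f n)) = real d ^ (n - 1) * real (degree f)"
        using shape by (simp add: shape_def assms(2))
      show "newton_polygon p (poly_iterate f n) z = newton_polygon p f (z / real d ^ (n - 1))"
        if "0 \<le> z" "z \<le> real (degree (poly_iterate f n))" for z
        using newton_polygon_shape[OF N shape] that deg assms(2) by (simp add: P_def)
    qed (use assms(3) in simp)
    ultimately show ?thesis by (simp add: assms(9) image_image)
  qed
  thus ?thesis using eventually_stable_f by blast
qed

end
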